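(* Let $N\ge 1$, let $T:\mathbb{R}_+^N\to\mathbb{R}_{++}^N$ be a continuous concave mapping, and let $\|\cdot\|_a$ and $\|\cdot\|_b$ be monotone norms on $\mathbb{R}^N$. Let $P:\mathbb{R}_{++}\to\mathbb{R}_{++}^N$, $U:\mathbb{R}_{++}\to\mathbb{R}_{++}$ and $E:\mathbb{R}_{++}\to\mathbb{R}_{++}$ be, respectively, the power function, the utility function, and the $\|\cdot\|_b$-energy efficiency function associated with the canonical utility maximization problem for $T$ and $\|\cdot\|_a$. Let $(\bar p_n)_{n\in\mathbb{N}}\subset\mathbb{R}_{++}$ be an arbitrary sequence converging to an arbitrary scalar $\bar p^\star\in\mathbb{R}_{++}$. Then: (i) $\lim_{n\to\infty}P(\bar p_n)=P(\bar p^\star)$; (ii) $\lim_{n\to\infty}U(\bar p_n)=U(\bar p^\star)$; and (iii) $\lim_{n\to\infty}E(\bar p_n)=E(\bar p^\star)$.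
   Context: Notation: $\mathbb{R}_+=[0,\infty)$, $\mathbb{R}_{++}=(0,\infty)$; vector inequalities are entrywise. A mapping $T:\mathbb{R}_+^N\to\mathbb{R}^N$ is concave if $T(\alpha x+(1-\alpha)y)\ge \alpha T(x)+(1-\alpha)T(y)$ for all $x,y\in\mathbb{R}_+^N$, $\alpha\in(0,1)$. A norm $\|\cdot\|$ on $\mathbb{R}^N$ is monotone if for all $x,y\in\mathbb{R}_+^N$, $x\ge y$ implies $\|x\|\ge\|y\|$. Canonical utility maximization problem: given a power budget $\bar p\in\mathbb{R}_{++}$, maximize $c$ over $(p,c)\in\mathbb{R}_+^N\times\mathbb{R}_{++}$ subject to $p=cT(p)$ and $\|p\|_a\le\bar p$. It is known that for every $\bar p>0$ this problem has a unique solution $(p^\star_{\bar p},c^\star_{\bar p})\in\mathbb{R}_{++}^N\times\mathbb{R}_{++}$, and that it is also the unique pair satisfying $T(p)=\frac1c p$ and $\|p\|_a=\bar p$. The utility function is $U:\mathbb{R}_{++}\to\mathbb{R}_{++}$, $U(\bar p)=c^\star_{\bar p}$, and the power function is $P:\mathbb{R}_{++}\to\mathbb{R}_{++}^N$, $P(\bar p)=p^\star_{\bar p}$. The $\|\cdot\|_b$-energy efficiency function is $E:\mathbb{R}_{++}\to\mathbb{R}_{++}$, $E(\bar p)=U(\bar p)/\|P(\bar p)\|_b$ (equivalently $1/\|T(P(\bar p))\|_b$). *)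

theory Defs
  imports "HOL-Analysis.Analysis"
begin

text \<open>
  On \<^typ>\<open>real ^ 'n\<close> the order \<open>\<le>\<close> is entrywise, but \<open>x < y\<close> only means \<open>x \<le> y \<and> x \<noteq> y\<close>;
  entrywise strict positivity is therefore written out with indices.
\<close>

definition nonneg_orthant :: "(real ^ 'n) set" where
  "nonneg_orthant = {x. 0 \<le> x}"

definition pos_orthant :: "(real ^ 'n) set" where
  "pos_orthant = {x. \<forall>i. 0 < x $ i}"

definition concave_mapping :: "(real ^ 'n \<Rightarrow> real ^ 'n) \<Rightarrow> bool" where
  "concave_mapping T \<longleftrightarrow>
    (\<forall>x\<in>nonneg_orthant. \<forall>y\<in>nonneg_orthant. \<forall>\<alpha>\<in>{0<..<1}.
      \<alpha> *\<^sub>R T x + (1 - \<alpha>) *\<^sub>R T y \<le> T (\<alpha> *\<^sub>R x + (1 - \<alpha>) *\<^sub>R y))"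

text \<open>
  An arbitrary norm on \<^typ>\<open>real ^ 'n\<close>; the constant \<^const>\<open>norm\<close> is only the Euclidean one.
\<close>

definition is_norm :: "('a::real_vector \<Rightarrow> real) \<Rightarrow> bool" where
  "is_norm \<nu> \<longleftrightarrow>
    (\<forall>x. 0 \<le> \<nu> x) \<and>
    (\<forall>x. \<nu> x = 0 \<longleftrightarrow> x = 0) \<and>
    (\<forall>r x. \<nu> (r *\<^sub>R x) = \<bar>r\<bar> * \<nu> x) \<and>
    (\<forall>x y. \<nu> (x + y) \<le> \<nu> x + \<nu> y)"

definition monotone_norm :: "(real ^ 'n \<Rightarrow> real) \<Rightarrow> bool" where
  "monotone_norm \<nu> \<longleftrightarrow>
    is_norm \<nu> \<and>
    (\<forall>x\<in>nonneg_orthant. \<forall>y\<in>nonneg_orthant. y \<le> x \<longrightarrow> \<nu> y \<le> \<nu> x)"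

definition feasible ::
    "(real ^ 'n \<Rightarrow> real ^ 'n) \<Rightarrow> (real ^ 'n \<Rightarrow> real) \<Rightarrow> real \<Rightarrow> (real ^ 'n) \<times> real \<Rightarrow> bool" where
  "feasible T \<nu> pbar = (\<lambda>(p, c).
    p \<in> nonneg_orthant \<and> 0 < c \<and> p = c *\<^sub>R T p \<and> \<nu> p \<le> pbar)"

definition canonical_solution ::
    "(real ^ 'n \<Rightarrow> real ^ 'n) \<Rightarrow> (real ^ 'n \<Rightarrow> real) \<Rightarrow> real \<Rightarrow> (real ^ 'n) \<times> real" where
  "canonical_solution T \<nu> pbar = (THE z. is_arg_max snd (feasible T \<nu> pbar) z)"

definition power_fun ::
    "(real ^ 'n \<Rightarrow> real ^ 'n) \<Rightarrow> (real ^ 'n \<Rightarrow> real) \<Rightarrow> real \<Rightarrow> real ^ 'n" where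
  "power_fun T \<nu> pbar = fst (canonical_solution T \<nu> pbar)"

definition utility_fun ::
    "(real ^ 'n \<Rightarrow> real ^ 'n) \<Rightarrow> (real ^ 'n \<Rightarrow> real) \<Rightarrow> real \<Rightarrow> real" where
  "utility_fun T \<nu> pbar = snd (canonical_solution T \<nu> pbar)"

definition energy_efficiency_fun ::
    "(real ^ 'n \<Rightarrow> real ^ 'n) \<Rightarrow> (real ^ 'n \<Rightarrow> real) \<Rightarrow> (real ^ 'n \<Rightarrow> real) \<Rightarrow> real \<Rightarrow> real" where
  "energy_efficiency_fun T \<nu>a \<nu>b pbar = utility_fun T \<nu>a pbar / \<nu>b (power_fun T \<nu>a pbar)"

end

theory Submission
  imports Defs
begin

text \<open>
  A concave positive mapping is monotone and strictly subhomogeneous, so the solutions of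
  \<open>p = c T p\<close> form a curve along which \<open>p\<close> is determined by \<open>c\<close> and the norm increases strictly with
  \<open>c\<close>. Brouwer's theorem applied to the normalised map \<open>x \<mapsto> (pbar / \<parallel>T x\<parallel>) T x\<close> gives a point of
  norm \<open>pbar\<close> on this curve, which therefore is the unique maximiser. Continuity of \<open>P\<close> follows
  because its graph is cut out by closed conditions and its values stay in a compact set.
\<close>

section \<open>Arbitrary norms in finite dimension\<close>

text \<open>A norm is convex, and a finite convex function on all of a Euclidean space is
  continuous.\<close>

lemma is_norm_continuous_on:
  fixes \<nu> :: "'a::euclidean_space \<Rightarrow> real"
  assumes "is_norm \<nu>"
  shows "continuous_on A \<nu>"
proof -
  have "convex_on UNIV \<nu>"
  proof (rule convex_onI)
    fix t :: real and x y :: 'a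
    assume "0 < t" "t < 1"
    have "\<nu> ((1 - t) *\<^sub>R x + t *\<^sub>R y) \<le> \<nu> ((1 - t) *\<^sub>R x) + \<nu> (t *\<^sub>R y)"
      using assms unfolding is_norm_def by blast
    also have "\<dots> = \<bar>1 - t\<bar> * \<nu> x + \<bar>t\<bar> * \<nu> y"
      using assms unfolding is_norm_def by metis
    finally show "\<nu> ((1 - t) *\<^sub>R x + t *\<^sub>R y) \<le> (1 - t) * \<nu> x + t * \<nu> y"
      using \<open>0 < t\<close> \<open>t < 1\<close> by simp
  qed simp
  then have "continuous_on UNIV \<nu>"
    by (rule convex_on_continuous[OF open_UNIV])
  then show ?thesis
    by (rule continuous_on_subset) simp
qed

text \<open>By homogeneity it suffices to bound \<open>\<nu>\<close> on the Euclidean unit sphere,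
  where it attains a positive minimum. This makes the sublevel sets of \<open>\<nu>\<close>
  bounded.\<close>

lemma is_norm_lower_bound:
  fixes \<nu> :: "'a::euclidean_space \<Rightarrow> real"
  assumes "is_norm \<nu>"
  obtains m where "0 < m" "\<And>x. m * norm x \<le> \<nu> x"
proof -
  have "sphere (0::'a) 1 \<noteq> {}" by simp
  then obtain z :: 'a where z: "z \<in> sphere 0 1" "\<And>y. y \<in> sphere 0 1 \<Longrightarrow> \<nu> z \<le> \<nu> y"
    using continuous_attains_inf[OF compact_sphere _ is_norm_continuous_on[OF assms]] by metis
  have "z \<noteq> 0" using z(1) by auto
  then have "0 < \<nu> z"
    using assms unfolding is_norm_def by (metis order_less_le)
  moreover have "\<nu> z * norm x \<le> \<nu> x" for x
  proof (cases "x = 0")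
    case True
    then show ?thesis using assms by (simp add: is_norm_def)
  next
    case False
    have "\<nu> z \<le> \<nu> ((1 / norm x) *\<^sub>R x)"
      using False by (intro z(2)) simp
    also have "\<dots> = \<nu> x / norm x"
      using assms by (simp add: is_norm_def)
    finally show ?thesis
      using False by (simp add: field_simps)
  qed
  ultimately show thesis by (rule that)
qed

lemma closed_nonneg_orthant: "closed (nonneg_orthant :: (real ^ 'n) set)"
  unfolding nonneg_orthant_def less_eq_vec_def
  by (intro closed_Collect_all closed_Collect_le continuous_intros)

text \<open>Used twice: as the compact convex domain for Brouwer's theorem and as the compact
  codomain in the closed graph argument.\<close>

definition truncated_orthant :: "(real ^ 'n \<Rightarrow> real) \<Rightarrow> real \<Rightarrow> (real ^ 'n) set" where
  "truncated_orthant \<nu> r = {x \<in> nonneg_orthant. \<nu> x \<le> r}"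

lemma compact_truncated_orthant:
  assumes "is_norm \<nu>"
  shows "compact (truncated_orthant \<nu> r)"
proof -
  obtain m where m: "0 < m" "\<And>x. m * norm x \<le> \<nu> x"
    using is_norm_lower_bound[OF assms] by blast
  have "norm x \<le> r / m" if "\<nu> x \<le> r" for x
    using m(1) m(2)[of x] that by (simp add: field_simps)
  then have "bounded (truncated_orthant \<nu> r)"
    unfolding truncated_orthant_def bounded_iff by blast
  moreover have "truncated_orthant \<nu> r = nonneg_orthant \<inter> {x. \<nu> x \<le> r}"
    by (auto simp: truncated_orthant_def)
  then have "closed (truncated_orthant \<nu> r)"
    by (auto intro!: closed_Int closed_nonneg_orthant closed_Collect_le continuous_intros
        is_norm_continuous_on[OF assms])
  ultimately show ?thesis by (simp add: compact_eq_bounded_closed)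
qed

lemma convex_truncated_orthant:
  assumes "is_norm \<nu>"
  shows "convex (truncated_orthant \<nu> r)"
proof (rule convexI)
  fix x y :: "real ^ 'a" and u v :: real
  assume xy: "x \<in> truncated_orthant \<nu> r" "y \<in> truncated_orthant \<nu> r"
    and uv: "0 \<le> u" "0 \<le> v" "u + v = 1"
  have "\<nu> (u *\<^sub>R x + v *\<^sub>R y) \<le> \<nu> (u *\<^sub>R x) + \<nu> (v *\<^sub>R y)"
    using assms unfolding is_norm_def by blast
  also have "\<dots> = \<bar>u\<bar> * \<nu> x + \<bar>v\<bar> * \<nu> y"
    using assms unfolding is_norm_def by metis
  also have "\<dots> \<le> u * r + v * r"
    using xy uv by (auto simp: truncated_orthant_def intro!: add_mono mult_left_mono)
  also have "\<dots> = r"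
    using uv by (simp add: distrib_right[symmetric])
  finally show "u *\<^sub>R x + v *\<^sub>R y \<in> truncated_orthant \<nu> r"
    using xy uv by (auto simp: truncated_orthant_def nonneg_orthant_def less_eq_vec_def)
qed

section \<open>Monotonicity and strict subhomogeneity from positivity and concavity\<close>

locale positive_concave =
  fixes T :: "real ^ 'n \<Rightarrow> real ^ 'n"
  assumes pos: "x \<in> nonneg_orthant \<Longrightarrow> 0 < T x $ i"
    and concave: "concave_mapping T"
begin

lemma nonneg: "x \<in> nonneg_orthant \<Longrightarrow> T x \<in> nonneg_orthant"
  using pos by (simp add: nonneg_orthant_def less_eq_vec_def less_imp_le)

lemma nonzero: "x \<in> nonneg_orthant \<Longrightarrow> T x \<noteq> 0"
  using pos by force

lemma concaveD:
  assumes "x \<in> nonneg_orthant" "y \<in> nonneg_orthant" "0 < \<alpha>" "\<alpha> < 1"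
  shows "\<alpha> * T x $ i + (1 - \<alpha>) * T y $ i \<le> T (\<alpha> *\<^sub>R x + (1 - \<alpha>) *\<^sub>R y) $ i"
proof -
  have "\<alpha> *\<^sub>R T x + (1 - \<alpha>) *\<^sub>R T y \<le> T (\<alpha> *\<^sub>R x + (1 - \<alpha>) *\<^sub>R y)"
    using concave assms by (simp add: concave_mapping_def)
  then show ?thesis by (simp add: less_eq_vec_def)
qed

text \<open>Extending the segment from \<open>x\<close> through \<open>y\<close> far into the orthant makes \<open>y\<close> a convex
  combination with weight arbitrarily close to \<open>1\<close> on \<open>x\<close>.\<close>

lemma mono:
  assumes "x \<in> nonneg_orthant" "x \<le> y"
  shows "T x \<le> T y"
  unfolding less_eq_vec_def
proof
  fix i
  show "T x $ i \<le> T y $ i"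
  proof (rule field_le_mult_one_interval)
    fix \<alpha> :: real
    assume \<alpha>: "0 < \<alpha>" "\<alpha> < 1"
    define z where "z = x + (1 / (1 - \<alpha>)) *\<^sub>R (y - x)"
    have z: "z \<in> nonneg_orthant"
      using assms \<alpha> by (auto simp: z_def nonneg_orthant_def less_eq_vec_def intro!: add_nonneg_nonneg)
    have "\<alpha> *\<^sub>R x + (1 - \<alpha>) *\<^sub>R z = y"
      using \<alpha> by (simp add: z_def algebra_simps)
    then have "\<alpha> * T x $ i + (1 - \<alpha>) * T z $ i \<le> T y $ i"
      using concaveD[OF assms(1) z \<alpha>] by simp
    moreover have "0 \<le> (1 - \<alpha>) * T z $ i"
      using pos[OF z, of i] \<alpha> by simp
    ultimately show "\<alpha> * T x $ i \<le> T y $ i" by linarith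
  qed
qed

text \<open>Concavity between \<open>x\<close> and the origin leaves the surplus
  \<open>(1 - \<alpha>) * T 0 $ i\<close>, which is strictly positive.\<close>

lemma strictly_subhomogeneous:
  assumes "x \<in> nonneg_orthant" "0 < \<alpha>" "\<alpha> < 1"
  shows "\<alpha> * T x $ i < T (\<alpha> *\<^sub>R x) $ i"
proof -
  have z: "(0 :: real ^ 'n) \<in> nonneg_orthant" by (simp add: nonneg_orthant_def)
  show ?thesis
    using concaveD[OF assms(1) z assms(2,3), of i] mult_pos_pos[of "1 - \<alpha>", OF _ pos[OF z, of i]]
      assms(3)
    by simp
qed

section \<open>Comparison along the solution curve of \<open>p = c T p\<close>\<close>

lemma eigenvector_pos:
  assumes "p \<in> nonneg_orthant" "0 < c" "p = c *\<^sub>R T p"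
  shows "0 < p $ i"
  using arg_cong[OF assms(3), of "\<lambda>v. v $ i"] mult_pos_pos[OF assms(2) pos[OF assms(1), of i]]
  by simp

text \<open>If the largest multiple of \<open>p\<close> below \<open>q\<close> had a factor under 1,
  strict subhomogeneity would separate the two vectors in every coordinate, including one where they
  touch. The case \<open>c = d\<close>, used in both directions, gives uniqueness of
  \<open>p\<close> for given \<open>c\<close>.\<close>

lemma eigenvector_mono:
  assumes p: "p \<in> nonneg_orthant" "0 < c" "p = c *\<^sub>R T p"
    and q: "q \<in> nonneg_orthant" "q = d *\<^sub>R T q"
    and "c \<le> d"
  shows "p \<le> q"
proof -
  have d: "0 < d" using p(2) \<open>c \<le> d\<close> by simp
  note pp = eigenvector_pos[OF p] and qp = eigenvector_pos[OF q(1) d q(2)]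
  \<comment> \<open>The largest \<open>\<alpha>\<close> with \<open>\<alpha> p \<le> q\<close>;
    equality holds at the minimising index \<open>j\<close>.\<close>
  define \<alpha> where "\<alpha> = Min (range (\<lambda>i. q $ i / p $ i))"
  have "\<alpha> \<in> range (\<lambda>i. q $ i / p $ i)"
    unfolding \<alpha>_def by (intro Min_in) auto
  then obtain j where j: "\<alpha> = q $ j / p $ j" by blast
  have le: "\<alpha> * p $ i \<le> q $ i" for i
  proof -
    have "\<alpha> \<le> q $ i / p $ i" unfolding \<alpha>_def by (intro Min_le) auto
    then show ?thesis using pp[of i] by (simp add: field_simps)
  qed
  have "0 < \<alpha>" using pp qp by (simp add: j)
  have "1 \<le> \<alpha>"
  proof (rule ccontr)
    assume "\<not> 1 \<le> \<alpha>"
    then have "\<alpha> < 1" by simp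
    have "\<alpha> *\<^sub>R p \<in> nonneg_orthant" "\<alpha> *\<^sub>R p \<le> q"
      using \<open>0 < \<alpha>\<close> pp le by (auto simp: nonneg_orthant_def less_eq_vec_def less_imp_le)
    then have "T (\<alpha> *\<^sub>R p) $ j \<le> T q $ j"
      using mono by (simp add: less_eq_vec_def)
    then have "\<alpha> * T p $ j < T q $ j"
      using strictly_subhomogeneous[OF p(1) \<open>0 < \<alpha>\<close> \<open>\<alpha> < 1\<close>, of j] by linarith
    \<comment> \<open>At \<open>j\<close> this yields
      \<open>\<alpha> p = c \<alpha> T p \<le> d \<alpha> T p < d T q = q\<close>, against the
      choice of \<open>j\<close>.\<close>
    then have "d * (\<alpha> * T p $ j) < d * T q $ j"
      using d by simp
    moreover have "c * (\<alpha> * T p $ j) \<le> d * (\<alpha> * T p $ j)"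
      using \<open>c \<le> d\<close> \<open>0 < \<alpha>\<close> pos[OF p(1), of j] by (intro mult_right_mono) auto
    moreover have "p $ j = c * T p $ j" "q $ j = d * T q $ j"
      using arg_cong[OF p(3), of "\<lambda>v. v $ j"] arg_cong[OF q(2), of "\<lambda>v. v $ j"] by simp_all
    ultimately have "\<alpha> * p $ j < q $ j" by (simp add: mult.left_commute)
    then show False using pp[of j] by (simp add: j)
  qed
  then have "p $ i \<le> q $ i" for i
    using order_trans[OF mult_right_mono[OF \<open>1 \<le> \<alpha>\<close>] le] pp[of i] by (simp add: less_imp_le)
  then show ?thesis by (simp add: less_eq_vec_def)
qed

text \<open>From \<open>p \<le> q\<close> follows \<open>p = c T p \<le> c T q = (c / d) q\<close>.
  Since \<open>c / d < 1\<close> and \<open>\<nu> q > 0\<close>, a monotone norm, although not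
  assumed strictly monotone, separates the two.\<close>

lemma eigenvector_norm_strict_mono:
  assumes \<nu>: "monotone_norm \<nu>"
    and p: "p \<in> nonneg_orthant" "0 < c" "p = c *\<^sub>R T p"
    and q: "q \<in> nonneg_orthant" "q = d *\<^sub>R T q"
    and "c < d"
  shows "\<nu> p < \<nu> q"
proof -
  have d: "0 < d" using p(2) \<open>c < d\<close> by simp
  have "q \<noteq> 0"
    using eigenvector_pos[OF q(1) d q(2)] by force
  then have "0 < \<nu> q"
    using \<nu> unfolding monotone_norm_def is_norm_def by (metis order_less_le)
  have "T p \<le> T q"
    using mono[OF p(1)] eigenvector_mono[OF p q] \<open>c < d\<close> by simp
  have "(c / d) *\<^sub>R q = c *\<^sub>R T q"
    using d by (subst q(2)) simp
  then have "p \<le> (c / d) *\<^sub>R q"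
    using \<open>T p \<le> T q\<close> p(2) by (subst p(3)) (simp add: less_eq_vec_def)
  moreover have "(c / d) *\<^sub>R q \<in> nonneg_orthant"
    using q(1) p(2) d by (simp add: nonneg_orthant_def less_eq_vec_def)
  ultimately have "\<nu> p \<le> \<nu> ((c / d) *\<^sub>R q)"
    using \<nu> p(1) unfolding monotone_norm_def by blast
  also have "\<dots> = c / d * \<nu> q"
    using \<nu> p(2) d by (simp add: monotone_norm_def is_norm_def)
  also have "\<dots> < \<nu> q"
    using \<open>0 < \<nu> q\<close> \<open>c < d\<close> d by (simp add: field_simps)
  finally show ?thesis .
qed

section \<open>Existence of a solution of prescribed norm\<close>

lemma eigenvector_exists:
  assumes cont: "continuous_on nonneg_orthant T" and "is_norm \<nu>" "0 < r"
  obtains p c where "p \<in> nonneg_orthant" "0 < c" "p = c *\<^sub>R T p" "\<nu> p = r"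
proof -
  let ?K = "truncated_orthant \<nu> r"
  \<comment> \<open>Rescaling puts every image on the level \<open>\<nu> = r\<close>, so a fixed
    point \<open>p\<close> has norm \<open>r\<close> and solves the equation with
    \<open>c = r / \<nu> (T p)\<close>.\<close>
  let ?f = "\<lambda>x. (r / \<nu> (T x)) *\<^sub>R T x"
  have K: "?K \<subseteq> nonneg_orthant" by (auto simp: truncated_orthant_def)
  have pos\<nu>: "0 < \<nu> (T x)" if "x \<in> nonneg_orthant" for x
    using nonzero[OF that] \<open>is_norm \<nu>\<close> unfolding is_norm_def by (metis order_less_le)
  have norm_f: "\<nu> (?f x) = r" if "x \<in> nonneg_orthant" for x
    using pos\<nu>[OF that] nonzero[OF that] \<open>is_norm \<nu>\<close> \<open>0 < r\<close> by (simp add: is_norm_def)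
  have "\<nu> 0 = 0" using \<open>is_norm \<nu>\<close> by (simp add: is_norm_def)
  then have "0 \<in> ?K"
    using \<open>0 < r\<close> by (simp add: truncated_orthant_def nonneg_orthant_def)
  moreover have "continuous_on ?K (\<lambda>x. \<nu> (T x))"
    using continuous_on_compose[OF cont is_norm_continuous_on[OF \<open>is_norm \<nu>\<close>]] K
    by (auto simp: o_def intro: continuous_on_subset)
  then have "continuous_on ?K ?f"
    using K pos\<nu> by (intro continuous_intros continuous_on_subset[OF cont]) force+
  moreover have "?f x \<in> ?K" if "x \<in> ?K" for x
  proof -
    have x: "x \<in> nonneg_orthant" using that K by blast
    then have "?f x \<in> nonneg_orthant"
      using nonneg[OF x] pos\<nu>[OF x] \<open>0 < r\<close> by (simp add: nonneg_orthant_def less_eq_vec_def)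
    then show ?thesis using norm_f[OF x] by (simp add: truncated_orthant_def)
  qed
  ultimately obtain p where p: "p \<in> ?K" "?f p = p"
    using brouwer[OF compact_truncated_orthant[OF \<open>is_norm \<nu>\<close>]
        convex_truncated_orthant[OF \<open>is_norm \<nu>\<close>], of r ?f] by blast
  have p0: "p \<in> nonneg_orthant" using p K by blast
  show thesis
  proof (rule that[OF p0])
    show "0 < r / \<nu> (T p)" using pos\<nu>[OF p0] \<open>0 < r\<close> by simp
    show "p = ?f p" using p by simp
    show "\<nu> p = r" using norm_f[OF p0] p by simp
  qed
qed

section \<open>The unique maximiser and its closed form\<close>

text \<open>A feasible pair with larger utility would have norm above \<open>r\<close>, and equal
  utilities force equal powers. This replaces the definite description by equations.\<close>

lemma canonical_solution_eqI:
  assumes \<nu>: "monotone_norm \<nu>"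
    and p: "p \<in> nonneg_orthant" "0 < c" "p = c *\<^sub>R T p" "\<nu> p = r"
  shows "canonical_solution T \<nu> r = (p, c)"
  unfolding canonical_solution_def
proof (rule the_equality)
  have feas: "feasible T \<nu> r (p, c)" using p by (simp add: feasible_def)
  have max: "d \<le> c" if "feasible T \<nu> r (q, d)" for q d
  proof (rule ccontr)
    assume "\<not> d \<le> c"
    then have "\<nu> p < \<nu> q"
      using that by (intro eigenvector_norm_strict_mono[OF \<nu> p(1-3)]) (auto simp: feasible_def)
    then show False using that p(4) by (simp add: feasible_def)
  qed
  show "is_arg_max snd (feasible T \<nu> r) (p, c)"
    using feas max by (auto simp: is_arg_max_linorder)
  fix z
  assume z: "is_arg_max snd (feasible T \<nu> r) z"
  obtain q d where [simp]: "z = (q, d)" by (cases z)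
  have qd: "feasible T \<nu> r (q, d)" and "c \<le> d"
    using z feas by (auto simp: is_arg_max_linorder)
  then have "d = c" using max by (simp add: order_antisym)
  moreover have "q = p"
  proof (rule order_antisym)
    have q: "q \<in> nonneg_orthant" "q = c *\<^sub>R T q"
      using qd unfolding \<open>d = c\<close> feasible_def by blast+
    show "q \<le> p" by (rule eigenvector_mono[OF q(1) p(2) q(2) p(1,3) order_refl])
    show "p \<le> q" by (rule eigenvector_mono[OF p(1-3) q order_refl])
  qed
  ultimately show "z = (p, c)" by simp
qed

text \<open>The last formula comes from applying \<open>\<nu>\<close> to \<open>p = c T p\<close>;
  it reduces continuity of the utility to that of the power.\<close>

lemma power_utility_spec:
  assumes "continuous_on nonneg_orthant T" and \<nu>: "monotone_norm \<nu>" and "0 < r"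
  shows "power_fun T \<nu> r \<in> nonneg_orthant"
    and "power_fun T \<nu> r = utility_fun T \<nu> r *\<^sub>R T (power_fun T \<nu> r)"
    and "\<nu> (power_fun T \<nu> r) = r"
    and "utility_fun T \<nu> r = r / \<nu> (T (power_fun T \<nu> r))"
proof -
  obtain p c where p: "p \<in> nonneg_orthant" "0 < c" "p = c *\<^sub>R T p" "\<nu> p = r"
    using eigenvector_exists[OF assms(1) _ \<open>0 < r\<close>] \<nu> unfolding monotone_norm_def by blast
  have [simp]: "power_fun T \<nu> r = p" "utility_fun T \<nu> r = c"
    using canonical_solution_eqI[OF \<nu> p] by (simp_all add: power_fun_def utility_fun_def)
  show "power_fun T \<nu> r \<in> nonneg_orthant"
    "power_fun T \<nu> r = utility_fun T \<nu> r *\<^sub>R T (power_fun T \<nu> r)"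
    "\<nu> (power_fun T \<nu> r) = r"
    using p by simp_all
  have "r = c * \<nu> (T p)"
    using \<nu> p(2,3,4) unfolding monotone_norm_def is_norm_def by (metis abs_of_pos)
  then have "c = r / \<nu> (T p)"
    using \<open>0 < r\<close> by auto
  then show "utility_fun T \<nu> r = r / \<nu> (T (power_fun T \<nu> r))"
    by simp
qed

text \<open>The fixed point equation is multiplied out by \<open>\<nu> (T p)\<close> so that, for \<open>(r, p)\<close> ranging over a
  closed set, it defines a closed relation not mentioning the utility.\<close>

lemma power_fun_eq_iff:
  assumes "continuous_on nonneg_orthant T" and \<nu>: "monotone_norm \<nu>" and "0 < r"
  shows "power_fun T \<nu> r = p \<longleftrightarrow> p \<in> nonneg_orthant \<and> \<nu> p = r \<and> \<nu> (T p) *\<^sub>R p = r *\<^sub>R T p"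
    (is "?L \<longleftrightarrow> ?R")
proof -
  have pos\<nu>: "0 < \<nu> (T p)" if "p \<in> nonneg_orthant" for p
    using nonzero[OF that] \<nu> unfolding monotone_norm_def is_norm_def by (metis order_less_le)
  show ?thesis
  proof
    assume ?L
    note spec = power_utility_spec[OF assms, unfolded \<open>?L\<close>]
    have "\<nu> (T p) *\<^sub>R p = (\<nu> (T p) * (r / \<nu> (T p))) *\<^sub>R T p"
      using spec(2) unfolding spec(4) by (metis scaleR_scaleR)
    then show ?R using spec pos\<nu>[of p] by simp
  next
    assume R: ?R
    then have "(1 / \<nu> (T p)) *\<^sub>R (\<nu> (T p) *\<^sub>R p) = (1 / \<nu> (T p)) *\<^sub>R (r *\<^sub>R T p)"
      by simp
    then have eq: "p = (r / \<nu> (T p)) *\<^sub>R T p"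
      using pos\<nu>[of p] conjunct1[OF R] by simp
    have "canonical_solution T \<nu> r = (p, r / \<nu> (T p))"
      using R pos\<nu>[of p] \<open>0 < r\<close> by (intro canonical_solution_eqI[OF \<nu> _ _ eq]) auto
    then show ?L by (simp add: power_fun_def)
  qed
qed

section \<open>Continuity of the power function\<close>

text \<open>A map into a compact set with closed graph is continuous. The values stay in
  \<open>truncated_orthant \<nu> b\<close> because the norm at budget \<open>r\<close> is exactly
  \<open>r \<le> b\<close>.\<close>

lemma continuous_on_power_fun:
  assumes cont: "continuous_on nonneg_orthant T" and \<nu>: "monotone_norm \<nu>" and "0 < a"
  shows "continuous_on {a..b} (power_fun T \<nu>)"
proof (rule continuous_from_closed_graph)
  have norm: "is_norm \<nu>" using \<nu> by (simp add: monotone_norm_def)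
  show "compact (truncated_orthant \<nu> b)"
    by (rule compact_truncated_orthant[OF norm])
  show "power_fun T \<nu> \<in> {a..b} \<rightarrow> truncated_orthant \<nu> b"
    using power_utility_spec[OF cont \<nu>] \<open>0 < a\<close> by (auto simp: truncated_orthant_def)
  let ?S = "{a..b} \<times> (nonneg_orthant :: (real ^ 'n) set)"
  have T: "continuous_on ?S (\<lambda>z. T (snd z))"
    by (rule continuous_on_compose2[OF cont continuous_on_snd[OF continuous_on_id]]) auto
  have \<nu>_snd: "continuous_on ?S (\<lambda>z. \<nu> (snd z))"
    by (rule continuous_on_compose2[OF is_norm_continuous_on[OF norm, of UNIV]])
      (auto intro!: continuous_intros)
  have \<nu>_T: "continuous_on ?S (\<lambda>z. \<nu> (T (snd z)))"
    by (rule continuous_on_compose2[OF is_norm_continuous_on[OF norm, of UNIV] T]) auto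
  have "closed ?S" by (intro closed_Times closed_nonneg_orthant closed_atLeastAtMost)
  \<comment> \<open>The graph is the zero set of \<open>?F\<close> in \<open>?S\<close>: the first
    component fixes the norm, the second is the multiplied-out fixed point equation. As
    \<open>?S\<close> is closed, continuity of \<open>?F\<close> on \<open>?S\<close> suffices for
    closedness.\<close>
  let ?F = "\<lambda>z. (\<nu> (snd z) - fst z, \<nu> (T (snd z)) *\<^sub>R snd z - fst z *\<^sub>R T (snd z))"
  have "continuous_on ?S ?F"
    by (intro continuous_intros \<nu>_snd \<nu>_T T)
  then have "closed (?S \<inter> ?F -` {0})"
    using \<open>closed ?S\<close> by (intro continuous_closed_preimage) auto
  moreover have "(\<lambda>r. (r, power_fun T \<nu> r)) ` {a..b} = ?S \<inter> ?F -` {0}"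
  proof (rule set_eqI)
    fix z :: "real \<times> (real ^ 'n)"
    obtain r p where z: "z = (r, p)" by (cases z)
    have "(r, p) \<in> (\<lambda>r. (r, power_fun T \<nu> r)) ` {a..b} \<longleftrightarrow> r \<in> {a..b} \<and> power_fun T \<nu> r = p"
      by auto
    also have "\<dots> \<longleftrightarrow> r \<in> {a..b} \<and> p \<in> nonneg_orthant \<and> \<nu> p = r \<and> \<nu> (T p) *\<^sub>R p = r *\<^sub>R T p"
      using power_fun_eq_iff[OF cont \<nu>, of r p] \<open>0 < a\<close> by auto
    also have "\<dots> \<longleftrightarrow> (r, p) \<in> ?S \<inter> ?F -` {0}"
      by (auto simp: zero_prod_def)
    finally show "z \<in> (\<lambda>r. (r, power_fun T \<nu> r)) ` {a..b} \<longleftrightarrow> z \<in> ?S \<inter> ?F -` {0}"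
      unfolding z .
  qed
  ultimately show "closed ((\<lambda>r. (r, power_fun T \<nu> r)) ` {a..b})" by simp
qed

lemma isCont_power_fun:
  assumes "continuous_on nonneg_orthant T" "monotone_norm \<nu>" "0 < r"
  shows "isCont (power_fun T \<nu>) r"
  \<comment> \<open>The interval from \<open>r / 2\<close> to \<open>2 * r\<close> has
    \<open>r\<close> in its interior and stays away from 0.\<close>
  using continuous_on_interior[OF continuous_on_power_fun[OF assms(1,2), of "r / 2" "2 * r"], of r]
    assms(3)
  by simp

end

theorem proposition3:
  fixes T :: "real ^ 'n \<Rightarrow> real ^ 'n"
    and norm_a norm_b :: "real ^ 'n \<Rightarrow> real"
    and pbar :: "nat \<Rightarrow> real"
    and pbar_lim :: real
  assumes "T ` nonneg_orthant \<subseteq> pos_orthant"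
    and "continuous_on nonneg_orthant T"
    and "concave_mapping T"
    and "monotone_norm norm_a"
    and "monotone_norm norm_b"
    and "\<And>n. 0 < pbar n"
    and "0 < pbar_lim"
    and "pbar \<longlonglongrightarrow> pbar_lim"
  shows "((\<lambda>n. power_fun T norm_a (pbar n)) \<longlonglongrightarrow> power_fun T norm_a pbar_lim) \<and>
         ((\<lambda>n. utility_fun T norm_a (pbar n)) \<longlonglongrightarrow> utility_fun T norm_a pbar_lim) \<and>
         ((\<lambda>n. energy_efficiency_fun T norm_a norm_b (pbar n))
            \<longlonglongrightarrow> energy_efficiency_fun T norm_a norm_b pbar_lim)"
proof -
  interpret positive_concave T
  proof
    show "0 < T x $ i" if "x \<in> nonneg_orthant" for x i
      using subsetD[OF assms(1) imageI[OF that]] by (simp add: pos_orthant_def)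
  qed (rule assms(3))
  let ?P = "power_fun T norm_a" and ?U = "utility_fun T norm_a"
  note cont = assms(2) and spec = power_utility_spec[OF assms(2,4)]
  have norms: "is_norm norm_a" "is_norm norm_b"
    using assms(4,5) by (simp_all add: monotone_norm_def)
  have norm_tendsto: "(\<lambda>n. \<nu> (x n)) \<longlonglongrightarrow> \<nu> l"
    if "is_norm \<nu>" "x \<longlonglongrightarrow> l" for \<nu> :: "real ^ 'n \<Rightarrow> real" and x l
    using continuous_on_tendsto_compose[OF is_norm_continuous_on[OF that(1), of UNIV] that(2)]
    by simp
  have P: "(\<lambda>n. ?P (pbar n)) \<longlonglongrightarrow> ?P pbar_lim"
    by (rule isCont_tendsto_compose[OF isCont_power_fun[OF cont assms(4,7)] assms(8)])
  \<comment> \<open>\<open>T\<close> is continuous only relative to the orthant, so the sequence and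
    its limit must both be known to lie there.\<close>
  have "(\<lambda>n. T (?P (pbar n))) \<longlonglongrightarrow> T (?P pbar_lim)"
    using spec(1) assms(6,7) by (intro continuous_on_tendsto_compose[OF cont P]) auto
  then have "(\<lambda>n. pbar n / norm_a (T (?P (pbar n)))) \<longlonglongrightarrow> pbar_lim / norm_a (T (?P pbar_lim))"
    using nonzero[OF spec(1)[OF assms(7)]] norms(1)
    by (intro tendsto_divide assms(8) norm_tendsto) (auto simp: is_norm_def)
  then have U: "(\<lambda>n. ?U (pbar n)) \<longlonglongrightarrow> ?U pbar_lim"
    using spec(4) assms(6,7) by simp
  \<comment> \<open>A power vector of positive \<open>norm_a\<close> is nonzero, hence has nonzero
    \<open>norm_b\<close>, so the quotient defining the energy efficiency passes to the
    limit.\<close>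
  have "norm_a (?P pbar_lim) \<noteq> 0"
    using spec(3)[OF assms(7)] assms(7) by simp
  then have "norm_b (?P pbar_lim) \<noteq> 0"
    using norms by (simp add: is_norm_def)
  then have "(\<lambda>n. ?U (pbar n) / norm_b (?P (pbar n))) \<longlonglongrightarrow> ?U pbar_lim / norm_b (?P pbar_lim)"
    by (intro tendsto_divide U norm_tendsto norms P)
  then show ?thesis
    using P U by (simp add: energy_efficiency_fun_def)
qed

end
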